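(* If $f:T\to X$ is $RL$ $m$-integrable on $T$, then $f$ is also Birkhoff simple $m$-integrable on $T$, and the two integrals coincide: $(Bs)\int_T f\,dm=(RL)\int_T f\,dm$.
   Context: $T$ is a nonempty, at least countable (i.e. infinite) set, $\mathcal{A}$ is a $\sigma$-algebra of subsets of $T$, $X$ is a real Banach space with norm $\|\cdot\|$, and $m:\mathcal{A}\to[0,+\infty)$ is an arbitrary set function with $m(\emptyset)=0$ (no additivity or monotonicity is assumed). A countable partition of $T$ is an at most countable family $\{A_n\}$ of pairwise disjoint nonempty sets of $\mathcal{A}$ with union $T$, enumerated as $A_0,A_1,\dots$ (if the family is finite, terms of the sums beyond the last set are taken to be $0$). For partitions $P,P'$ of $T$, write $P'\ge P$ if every set of $P'$ is included in some set of $P$. A function $f:T\to X$ is $RL$ (unconditionally Riemann-Lebesgue) $m$-integrable on $T$ if there is $b\in X$ such that for every $\varepsilon>0$ there is a countable partition $P_\varepsilon$ of $T$ such that for every countable partition $P=\{A_n\}$ of $T$ with $P\ge P_\varepsilon$: $f$ is bounded on every $A_n$ with $m(A_n)>0$, and for every choice of points $t_n\in A_n$ the series $\sum_n f(t_n)m(A_n)$ is unconditionally convergent and $\|\sum_n f(t_n)m(A_n)-b\|<\varepsilon$. The vector $b$ is unique and is denoted $(RL)\int_T f\,dm$. A function $f:T\to X$ is Birkhoff simple $m$-integrable on $T$ if there is $a\in X$ such that for every $\varepsilon>0$ there is a countable partition $P_\varepsilon$ of $T$ such that for every countable partition $P=\{A_n\}$ of $T$ with $P\ge P_\varepsilon$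 and every choice $t_n\in A_n$ one has $\limsup_{n\to+\infty}\|\sum_{k=0}^{n}f(t_k)m(A_k)-a\|<\varepsilon$. The vector $a$ is denoted $(Bs)\int_T f\,dm$. *)

theory Defs
  imports "HOL-Analysis.Analysis"
begin

definition countable_partition :: "'a set \<Rightarrow> 'a set set \<Rightarrow> 'a set set \<Rightarrow> bool" where
  "countable_partition T \<A> P \<longleftrightarrow> partition_on T P \<and> countable P \<and> P \<subseteq> \<A>"

text \<open>
  \<open>enumerates I A P\<close>: the family \<open>P\<close> is listed without repetition as \<open>A 0, A 1, \<dots>\<close>. The index set
  \<open>I\<close> is \<open>{..<N}\<close> if \<open>P\<close> has \<open>N\<close> members and all of \<open>nat\<close> if \<open>P\<close> is infinite; the values of \<open>A\<close>
  outside \<open>I\<close> are irrelevant.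
\<close>

definition enumerates :: "nat set \<Rightarrow> (nat \<Rightarrow> 'a set) \<Rightarrow> 'a set set \<Rightarrow> bool" where
  "enumerates I A P \<longleftrightarrow> (I = UNIV \<or> (\<exists>N. I = {..<N})) \<and> bij_betw A I P"

definition rl_term ::
    "('a set \<Rightarrow> real) \<Rightarrow> ('a \<Rightarrow> 'b::real_normed_vector) \<Rightarrow> nat set \<Rightarrow> (nat \<Rightarrow> 'a set) \<Rightarrow> (nat \<Rightarrow> 'a) \<Rightarrow> nat \<Rightarrow> 'b" where
  "rl_term m f I A t n = (if n \<in> I then m (A n) *\<^sub>R f (t n) else 0)"

definition unconditionally_convergent :: "(nat \<Rightarrow> 'b::real_normed_vector) \<Rightarrow> bool" where
  "unconditionally_convergent x \<longleftrightarrow> (\<forall>\<pi>. bij \<pi> \<longrightarrow> summable (\<lambda>n. x (\<pi> n)))"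

text \<open>
  In both definitions below every enumeration of a refining partition is considered; the partial
  sums in the Birkhoff simple case depend on it. Note that \<open>refines T P Q\<close> says that \<open>P\<close> is the
  finer partition.
\<close>

definition has_RL_integral ::
    "'a set \<Rightarrow> 'a set set \<Rightarrow> ('a set \<Rightarrow> real) \<Rightarrow> ('a \<Rightarrow> 'b::banach) \<Rightarrow> 'b \<Rightarrow> bool" where
  "has_RL_integral T \<A> m f b \<longleftrightarrow>
     (\<forall>\<epsilon>>0. \<exists>P\<^sub>\<epsilon>. countable_partition T \<A> P\<^sub>\<epsilon> \<and>
       (\<forall>P I A. countable_partition T \<A> P \<and> refines T P P\<^sub>\<epsilon> \<and> enumerates I A P \<longrightarrow>
          (\<forall>n\<in>I. m (A n) > 0 \<longrightarrow> bounded (f ` A n)) \<and>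
          (\<forall>t. (\<forall>n\<in>I. t n \<in> A n) \<longrightarrow>
             unconditionally_convergent (rl_term m f I A t) \<and>
             norm ((\<Sum>n. rl_term m f I A t n) - b) < \<epsilon>)))"

definition RL_integrable ::
    "'a set \<Rightarrow> 'a set set \<Rightarrow> ('a set \<Rightarrow> real) \<Rightarrow> ('a \<Rightarrow> 'b::banach) \<Rightarrow> bool" where
  "RL_integrable T \<A> m f \<longleftrightarrow> (\<exists>b. has_RL_integral T \<A> m f b)"

definition RL_integral ::
    "'a set \<Rightarrow> 'a set set \<Rightarrow> ('a set \<Rightarrow> real) \<Rightarrow> ('a \<Rightarrow> 'b::banach) \<Rightarrow> 'b" where
  "RL_integral T \<A> m f = (THE b. has_RL_integral T \<A> m f b)"

text \<open>The \<open>limsup\<close> is taken in \<open>ereal\<close>, so unbounded partial sums give the value \<open>\<infinity>\<close>.\<close>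

definition has_Bs_integral ::
    "'a set \<Rightarrow> 'a set set \<Rightarrow> ('a set \<Rightarrow> real) \<Rightarrow> ('a \<Rightarrow> 'b::banach) \<Rightarrow> 'b \<Rightarrow> bool" where
  "has_Bs_integral T \<A> m f a \<longleftrightarrow>
     (\<forall>\<epsilon>>0. \<exists>P\<^sub>\<epsilon>. countable_partition T \<A> P\<^sub>\<epsilon> \<and>
       (\<forall>P I A t. countable_partition T \<A> P \<and> refines T P P\<^sub>\<epsilon> \<and> enumerates I A P \<and>
            (\<forall>n\<in>I. t n \<in> A n) \<longrightarrow>
          limsup (\<lambda>n. ereal (norm ((\<Sum>k=0..n. rl_term m f I A t k) - a))) < ereal \<epsilon>))"

definition Bs_integrable ::
    "'a set \<Rightarrow> 'a set set \<Rightarrow> ('a set \<Rightarrow> real) \<Rightarrow> ('a \<Rightarrow> 'b::banach) \<Rightarrow> bool" where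
  "Bs_integrable T \<A> m f \<longleftrightarrow> (\<exists>a. has_Bs_integral T \<A> m f a)"

definition Bs_integral ::
    "'a set \<Rightarrow> 'a set set \<Rightarrow> ('a set \<Rightarrow> real) \<Rightarrow> ('a \<Rightarrow> 'b::banach) \<Rightarrow> 'b" where
  "Bs_integral T \<A> m f = (THE a. has_Bs_integral T \<A> m f a)"

end

theory Submission imports Defs begin

text \<open>
  Unconditional convergence includes convergence for the given enumeration. Hence, for every tagged
  partition admitted in the Riemann-Lebesgue definition, the distances between the partial sums and
  \<open>b\<close> converge to the distance between the sum of the series and \<open>b\<close>, so their \<open>limsup\<close> is that
  distance and is below \<open>\<epsilon>\<close>. The same \<open>P\<^sub>\<epsilon>\<close> therefore serves for both notions, and a
  Riemann-Lebesgue integral is a Birkhoff simple integral with the same value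
  (\<open>has_RL_integral_imp_has_Bs_integral\<close>).

  Both integrals are defined by definite description, so comparing them requires uniqueness. For the
  Birkhoff simple integral it holds because any two countable partitions have a common countable
  refinement: the partial sums over one enumeration and one choice of tags are then eventually close
  to both candidate values (\<open>has_Bs_integral_unique\<close>). Uniqueness for the Riemann-Lebesgue integral
  is inherited through the implication above.
\<close>

lemma countable_partition_common_refinement:
  assumes "sigma_algebra T \<A>"
    and "countable_partition T \<A> P" and "countable_partition T \<A> Q"
  obtains R where "countable_partition T \<A> R" "refines T R P" "refines T R Q"
proof -
  interpret sigma_algebra T \<A> by fact
  define R where "R = common_refinement {P, Q}"
  have parts: "\<And>S. S \<in> {P, Q} \<Longrightarrow> partition_on T S"
    using assms by (auto simp: countable_partition_def)
  have sub: "R \<subseteq> (\<lambda>(p, q). p \<inter> q) ` (P \<times> Q)"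
    by (auto simp: R_def common_refinement)
  then have "countable R"
    using assms by (meson countable_SIGMA countable_image countable_partition_def countable_subset)
  moreover have "R \<subseteq> \<A>"
    using sub assms by (fastforce simp: countable_partition_def)
  moreover have "partition_on T R"
    unfolding R_def by (rule partition_on_common_refinement) (use parts in auto)
  ultimately have "countable_partition T \<A> R"
    by (simp add: countable_partition_def)
  moreover have "refines T R P" "refines T R Q"
    unfolding R_def by (rule refines_common_refinement; use parts in auto)+
  ultimately show thesis by (rule that)
qed

text \<open>
  Both integrals quantify over all enumerations and all tags, so their conditions could be vacuous
  for a partition without any; this rules that out in the uniqueness argument.
\<close>

lemma countable_partition_enumeration_with_tags:
  assumes "countable_partition T \<A> P"
  obtains I A t where "enumerates I A P" "\<forall>n\<in>I. t n \<in> A n"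
proof -
  have P: "countable P" "{} \<notin> P"
    using assms by (auto simp: countable_partition_def partition_on_def)
  obtain I A where enum: "enumerates I A P"
    using bij_betw_from_nat_into_finite[of P] bij_betw_from_nat_into[of P] P(1)
    unfolding enumerates_def by (cases "finite P") blast+
  have "\<forall>n\<in>I. \<exists>x. x \<in> A n"
    using enum P(2) by (metis all_not_in_conv bij_betwE enumerates_def)
  then obtain t where "\<forall>n\<in>I. t n \<in> A n"
    by metis
  with enum show thesis by (rule that)
qed

lemma has_Bs_integral_unique:
  assumes "sigma_algebra T \<A>" and a: "has_Bs_integral T \<A> m f a" and b: "has_Bs_integral T \<A> m f b"
  shows "a = b"
proof -
  have "dist a b \<le> e" if "e > 0" for e
  proof -
    have "e / 2 > 0" using that by simp
    obtain P where P: "countable_partition T \<A> P"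
      and Pa: "\<And>R I A t. countable_partition T \<A> R \<Longrightarrow> refines T R P \<Longrightarrow> enumerates I A R \<Longrightarrow>
        \<forall>n\<in>I. t n \<in> A n \<Longrightarrow>
        limsup (\<lambda>n. ereal (norm ((\<Sum>k=0..n. rl_term m f I A t k) - a))) < ereal (e / 2)"
      using a \<open>e / 2 > 0\<close> unfolding has_Bs_integral_def by meson
    obtain Q where Q: "countable_partition T \<A> Q"
      and Qb: "\<And>R I A t. countable_partition T \<A> R \<Longrightarrow> refines T R Q \<Longrightarrow> enumerates I A R \<Longrightarrow>
        \<forall>n\<in>I. t n \<in> A n \<Longrightarrow>
        limsup (\<lambda>n. ereal (norm ((\<Sum>k=0..n. rl_term m f I A t k) - b))) < ereal (e / 2)"
      using b \<open>e / 2 > 0\<close> unfolding has_Bs_integral_def by meson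
    obtain R where R: "countable_partition T \<A> R" "refines T R P" "refines T R Q"
      using countable_partition_common_refinement[OF assms(1) P Q] .
    obtain I A t where t: "enumerates I A R" "\<forall>n\<in>I. t n \<in> A n"
      using countable_partition_enumeration_with_tags[OF R(1)] .
    define s where "s n = (\<Sum>k=0..n. rl_term m f I A t k)" for n
    have "\<forall>\<^sub>F n in sequentially. norm (s n - a) < e / 2"
      using Limsup_lessD[OF Pa[OF R(1,2) t]] by (simp add: s_def)
    moreover have "\<forall>\<^sub>F n in sequentially. norm (s n - b) < e / 2"
      using Limsup_lessD[OF Qb[OF R(1,3) t]] by (simp add: s_def)
    ultimately have "\<forall>\<^sub>F n in sequentially. dist a b < e"
      by eventually_elim (metis dist_norm dist_triangle_half_r)
    then show "dist a b \<le> e"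
      by simp
  qed
  then have "dist a b \<le> 0"
    using field_le_epsilon[of "dist a b" 0] by simp
  then show "a = b"
    by simp
qed

lemma has_RL_integral_imp_has_Bs_integral:
  assumes "has_RL_integral T \<A> m f b"
  shows "has_Bs_integral T \<A> m f b"
  unfolding has_Bs_integral_def
proof (intro allI impI)
  fix e :: real assume "e > 0"
  then obtain P where P: "countable_partition T \<A> P"
    and RL: "\<And>R I A t. countable_partition T \<A> R \<Longrightarrow> refines T R P \<Longrightarrow> enumerates I A R \<Longrightarrow>
      \<forall>n\<in>I. t n \<in> A n \<Longrightarrow> unconditionally_convergent (rl_term m f I A t) \<and>
        norm ((\<Sum>n. rl_term m f I A t n) - b) < e"
    using assms unfolding has_RL_integral_def by meson
  have "limsup (\<lambda>n. ereal (norm ((\<Sum>k=0..n. rl_term m f I A t k) - b))) < ereal e"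
    if "countable_partition T \<A> R" "refines T R P" "enumerates I A R" "\<forall>n\<in>I. t n \<in> A n"
    for R I A t
  proof -
    let ?x = "rl_term m f I A t"
    have "summable ?x"
      using RL[OF that] bij_id unfolding unconditionally_convergent_def by force
    then have "(\<lambda>n. \<Sum>k=0..n. ?x k) \<longlonglongrightarrow> suminf ?x"
      using summable_LIMSEQ' by (simp add: atLeast0AtMost)
    then have "(\<lambda>n. ereal (norm ((\<Sum>k=0..n. ?x k) - b))) \<longlonglongrightarrow> ereal (norm (suminf ?x - b))"
      by (intro tendsto_intros)
    then have "limsup (\<lambda>n. ereal (norm ((\<Sum>k=0..n. ?x k) - b))) = ereal (norm (suminf ?x - b))"
      by (intro lim_imp_Limsup) simp_all
    then show ?thesis
      using RL[OF that] by simp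
  qed
  with P show "\<exists>P. countable_partition T \<A> P \<and>
      (\<forall>R I A t. countable_partition T \<A> R \<and> refines T R P \<and> enumerates I A R \<and>
        (\<forall>n\<in>I. t n \<in> A n) \<longrightarrow>
        limsup (\<lambda>n. ereal (norm ((\<Sum>k=0..n. rl_term m f I A t k) - b))) < ereal e)"
    by blast
qed

theorem theorem4p2:
  fixes T :: "'a set" and \<A> :: "'a set set" and m :: "'a set \<Rightarrow> real"
    and f :: "'a \<Rightarrow> 'b::banach"
  assumes "infinite T"
    and "sigma_algebra T \<A>"
    and "\<And>E. E \<in> \<A> \<Longrightarrow> 0 \<le> m E"
    and "m {} = 0"
    and "RL_integrable T \<A> m f"
  shows "Bs_integrable T \<A> m f \<and> Bs_integral T \<A> m f = RL_integral T \<A> m f"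
proof -
  obtain b where RL: "has_RL_integral T \<A> m f b"
    using assms(5) unfolding RL_integrable_def by blast
  then have Bs: "has_Bs_integral T \<A> m f b"
    by (rule has_RL_integral_imp_has_Bs_integral)
  have "Bs_integral T \<A> m f = b"
    unfolding Bs_integral_def using Bs has_Bs_integral_unique[OF assms(2)] by blast
  moreover have "RL_integral T \<A> m f = b"
    unfolding RL_integral_def
    using RL has_Bs_integral_unique[OF assms(2)] has_RL_integral_imp_has_Bs_integral by blast
  ultimately show ?thesis
    using Bs unfolding Bs_integrable_def by auto
qed

end
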